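(* The forgetful functors $\Psi:\mathsf{PM}\to\mathsf{WPM}$ (from partial monoids to weak partial monoids) and $\Phi:\mathsf{WPM}\to\mathsf{Mag}$ (from weak partial monoids to partial unital magmas), and the functor $(-)^\sharp:\mathsf{Mag}\to\mathsf{Mag}^{\mathrm{ad}}$ which equips a partial unital magma with its maximal associativity datum $A_n=F_n(M)$, $n\ge 2$, are fully faithful.
   Context: A partial unital magma $(M,\cdot,1)$ is a set $M$ with a partially defined binary operation $\cdot$ (defined on a subset of $M\times M$ whose elements are called multiplicable pairs) and an element $1\in M$ such that for every $m\in M$ the pairs $(m,1),(1,m)$ are multiplicable and $m\cdot 1=m=1\cdot m$. A morphism is a map of sets $f$ with $f(1)=1$ such that if $(m,n)$ is multiplicable then $(f(m),f(n))$ is multiplicable and $f(m\cdot n)=f(m)\cdot f(n)$. The category is $\mathsf{Mag}$. A binary bracketing of $n\ge2$ is an isomorphism class of planar binary rooted trees $T$ with $n$ leaves; it gives a partially defined $n$-ary operation $\cdot^T:M^{\times n}\to M$ by performing $\cdot$ at every vertex of $T$. A tuple in $M^{\times n}$ is multiplicable if it lies in the domain of $\cdot^T$ for every bracketing $T$ of $n$. $M$ is weakly associative (a weak partial monoid) if for every multiplicable tuple all bracketed products agree. $M$ is associative (a partial monoid) if it is weakly associative and an $n$-tuple is multiplicable if and only if it lies in the domain of $\cdot^T$ for at least one bracketing $T$ of $n$. $\mathsf{WPM}$ and $\mathsf{PM}$ are the categories of weak partial monoids and of partial monoids; in both, morphisms are maps of sets preserving the unit and such that if $(m,n)$ is multiplicable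 then so is $(f(m),f(n))$, with $f(m\cdot n)=f(m)\cdot f(n)$. A multiplicable $n$-tuple is associable if all its bracketed products agree; a multiplicable tuple $(b_1,\dots,b_n)$ is fully associable if each $(b_i,b_{i+1},\dots,b_j)$, $1\le i<j\le n$, is associable. $F_n(M)$ is the set of fully associable $n$-tuples. An associativity datum on $M$ is a family of subsets $A_n\subset F_n(M)$, $n\ge2$ (with the convention $A_1=M$), such that: (1) $A_2$ is the domain of $\cdot$; (2) if $(b_1,\dots,b_n)\in A_n$ then for any $1\le i<n$, $(b_1,\dots,b_i)\in A_i$ and $(b_{i+1},\dots,b_n)\in A_{n-i}$; (3) if $(b_1,\dots,b_n)\in A_n$ then $(b_1,\dots,b_{i-1},1,b_i,\dots,b_n)\in A_{n+1}$ for any $1\le i\le n+1$. $\mathsf{Mag}^{\mathrm{ad}}$ is the category of partial unital magmas equipped with an associativity datum; morphisms $(M,A^M)\to(N,A^N)$ are morphisms $f$ of partial unital magmas with $f^{\times n}(A^M_n)\subset A^N_n$ for all $n$. *)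

theory Defs
  imports Main "HOL-Library.FuncSet"
begin

section \<open>Categories and functors\<close>

text \<open>
  Hom-sets are indexed by pairs of objects and need not be disjoint, so identities and composition
  carry their objects as arguments: \<open>Comp C X Y Z g f\<close> is \<open>g \<circ> f\<close> for \<open>f : X \<rightarrow> Y\<close>, \<open>g : Y \<rightarrow> Z\<close>.
\<close>

record ('o, 'm) cat =
  Obj :: "'o set"
  Hom :: "'o \<Rightarrow> 'o \<Rightarrow> 'm set"
  Id :: "'o \<Rightarrow> 'm"
  Comp :: "'o \<Rightarrow> 'o \<Rightarrow> 'o \<Rightarrow> 'm \<Rightarrow> 'm \<Rightarrow> 'm"

locale category =
  fixes C :: "('o, 'm) cat"
  assumes Id_in_Hom: "X \<in> Obj C \<Longrightarrow> Id C X \<in> Hom C X X"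
    and Comp_in_Hom:
      "\<lbrakk>X \<in> Obj C; Y \<in> Obj C; Z \<in> Obj C; f \<in> Hom C X Y; g \<in> Hom C Y Z\<rbrakk>
        \<Longrightarrow> Comp C X Y Z g f \<in> Hom C X Z"
    and Comp_Id_right:
      "\<lbrakk>X \<in> Obj C; Y \<in> Obj C; f \<in> Hom C X Y\<rbrakk> \<Longrightarrow> Comp C X X Y f (Id C X) = f"
    and Comp_Id_left:
      "\<lbrakk>X \<in> Obj C; Y \<in> Obj C; f \<in> Hom C X Y\<rbrakk> \<Longrightarrow> Comp C X Y Y (Id C Y) f = f"
    and Comp_assoc:
      "\<lbrakk>W \<in> Obj C; X \<in> Obj C; Y \<in> Obj C; Z \<in> Obj C;
        f \<in> Hom C W X; g \<in> Hom C X Y; h \<in> Hom C Y Z\<rbrakk>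
        \<Longrightarrow> Comp C W Y Z h (Comp C W X Y g f) = Comp C W X Z (Comp C X Y Z h g) f"

record ('o, 'm, 'p, 'n) functor_data =
  Ob_map :: "'o \<Rightarrow> 'p"
  Hom_map :: "'o \<Rightarrow> 'o \<Rightarrow> 'm \<Rightarrow> 'n"

locale cat_functor = source: category C + target: category D
  for C :: "('o, 'm) cat" and D :: "('p, 'n) cat" +
  fixes F :: "('o, 'm, 'p, 'n) functor_data"
  assumes Ob_map_in_Obj: "X \<in> Obj C \<Longrightarrow> Ob_map F X \<in> Obj D"
    and Hom_map_in_Hom:
      "\<lbrakk>X \<in> Obj C; Y \<in> Obj C; f \<in> Hom C X Y\<rbrakk>
        \<Longrightarrow> Hom_map F X Y f \<in> Hom D (Ob_map F X) (Ob_map F Y)"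
    and Hom_map_Id: "X \<in> Obj C \<Longrightarrow> Hom_map F X X (Id C X) = Id D (Ob_map F X)"
    and Hom_map_Comp:
      "\<lbrakk>X \<in> Obj C; Y \<in> Obj C; Z \<in> Obj C; f \<in> Hom C X Y; g \<in> Hom C Y Z\<rbrakk>
        \<Longrightarrow> Hom_map F X Z (Comp C X Y Z g f)
            = Comp D (Ob_map F X) (Ob_map F Y) (Ob_map F Z) (Hom_map F Y Z g) (Hom_map F X Y f)"

definition fully_faithful_functor ::
  "('o, 'm) cat \<Rightarrow> ('p, 'n) cat \<Rightarrow> ('o, 'm, 'p, 'n) functor_data \<Rightarrow> bool" where
  "fully_faithful_functor C D F \<longleftrightarrow>
     cat_functor C D F \<and>
     (\<forall>X\<in>Obj C. \<forall>Y\<in>Obj C.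
        bij_betw (Hom_map F X Y) (Hom C X Y) (Hom D (Ob_map F X) (Ob_map F Y)))"


section \<open>Partial unital magmas\<close>

text \<open>
  The partial operation is option-valued: \<open>mult M x y = None\<close> means that \<open>(x, y)\<close> is not multiplicable.
\<close>

record 'a magma =
  carrier :: "'a set"
  mult :: "'a \<Rightarrow> 'a \<Rightarrow> 'a option"
  unit :: 'a

definition partial_unital_magma :: "'a magma \<Rightarrow> bool" where
  "partial_unital_magma M \<longleftrightarrow>
     unit M \<in> carrier M \<and>
     (\<forall>x y z. mult M x y = Some z \<longrightarrow> x \<in> carrier M \<and> y \<in> carrier M \<and> z \<in> carrier M) \<and>
     (\<forall>x\<in>carrier M. mult M x (unit M) = Some x \<and> mult M (unit M) x = Some x)"

text \<open>
  A morphism is a map of sets between the carriers, represented by the function that is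
  \<open>undefined\<close> off the source carrier.
\<close>

definition magma_hom :: "'a magma \<Rightarrow> 'b magma \<Rightarrow> ('a \<Rightarrow> 'b) set" where
  "magma_hom M N =
     {f \<in> carrier M \<rightarrow>\<^sub>E carrier N.
        f (unit M) = unit N \<and>
        (\<forall>x y z. mult M x y = Some z \<longrightarrow> mult N (f x) (f y) = Some (f z))}"


section \<open>Bracketings and associativity\<close>

text \<open>Every isomorphism class of planar binary rooted trees has exactly one representative here.\<close>

datatype bracketing = Leaf | Node bracketing bracketing

fun leaves :: "bracketing \<Rightarrow> nat" where
  "leaves Leaf = 1"
| "leaves (Node S T) = leaves S + leaves T"

text \<open>
  The partial operation of a tree; \<open>None\<close> on tuples outside its domain, in particular on tuples
  whose length is not the number of leaves.
\<close>

fun bracket_prod :: "'a magma \<Rightarrow> bracketing \<Rightarrow> 'a list \<Rightarrow> 'a option" where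
  "bracket_prod M Leaf xs = (case xs of [x] \<Rightarrow> Some x | _ \<Rightarrow> None)"
| "bracket_prod M (Node S T) xs =
     (case (bracket_prod M S (take (leaves S) xs), bracket_prod M T (drop (leaves S) xs)) of
        (Some x, Some y) \<Rightarrow> mult M x y
      | _ \<Rightarrow> None)"

definition tuples :: "'a magma \<Rightarrow> nat \<Rightarrow> 'a list set" where
  "tuples M n = {b. length b = n \<and> set b \<subseteq> carrier M}"

definition multiplicable :: "'a magma \<Rightarrow> 'a list \<Rightarrow> bool" where
  "multiplicable M b \<longleftrightarrow>
     2 \<le> length b \<and> b \<in> tuples M (length b) \<and>
     (\<forall>T. leaves T = length b \<longrightarrow> bracket_prod M T b \<noteq> None)"

definition associable :: "'a magma \<Rightarrow> 'a list \<Rightarrow> bool" where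
  "associable M b \<longleftrightarrow>
     multiplicable M b \<and>
     (\<forall>S T. leaves S = length b \<longrightarrow> leaves T = length b \<longrightarrow>
        bracket_prod M S b = bracket_prod M T b)"

definition weakly_associative :: "'a magma \<Rightarrow> bool" where
  "weakly_associative M \<longleftrightarrow> (\<forall>b. multiplicable M b \<longrightarrow> associable M b)"

definition associative :: "'a magma \<Rightarrow> bool" where
  "associative M \<longleftrightarrow>
     weakly_associative M \<and>
     (\<forall>n\<ge>2. \<forall>b\<in>tuples M n.
        multiplicable M b \<longleftrightarrow> (\<exists>T. leaves T = n \<and> bracket_prod M T b \<noteq> None))"


section \<open>Associativity data\<close>

text \<open>\<open>slice i j (b\<^sub>1, \<dots>, b\<^sub>n) = (b\<^sub>i, \<dots>, b\<^sub>j)\<close>, for \<open>1 \<le> i \<le> j \<le> n\<close>.\<close>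

definition slice :: "nat \<Rightarrow> nat \<Rightarrow> 'a list \<Rightarrow> 'a list" where
  "slice i j b = drop (i - 1) (take j b)"

definition fully_associable :: "'a magma \<Rightarrow> 'a list \<Rightarrow> bool" where
  "fully_associable M b \<longleftrightarrow>
     multiplicable M b \<and>
     (\<forall>i j. 1 \<le> i \<and> i < j \<and> j \<le> length b \<longrightarrow> associable M (slice i j b))"

text \<open>
  A family of sets of tuples is indexed by all natural numbers. Only the indices \<open>n \<ge> 2\<close> carry
  information: the value at 1 is fixed by the convention \<open>A\<^sub>1 = M\<close>, and the value at 0 by \<open>A\<^sub>0 = \<emptyset>\<close>.
\<close>

definition associativity_datum :: "'a magma \<Rightarrow> (nat \<Rightarrow> 'a list set) \<Rightarrow> bool" where
  "associativity_datum M A \<longleftrightarrow>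
     A 0 = {} \<and> A 1 = tuples M 1 \<and>
     (\<forall>n\<ge>2. A n \<subseteq> {b \<in> tuples M n. fully_associable M b}) \<and>
     A 2 = {[x, y] | x y. mult M x y \<noteq> None} \<and>
     (\<forall>n\<ge>2. \<forall>b\<in>A n. \<forall>i. 1 \<le> i \<and> i < n \<longrightarrow> take i b \<in> A i \<and> drop i b \<in> A (n - i)) \<and>
     (\<forall>n\<ge>2. \<forall>b\<in>A n. \<forall>i. 1 \<le> i \<and> i \<le> n + 1 \<longrightarrow>
        take (i - 1) b @ [unit M] @ drop (i - 1) b \<in> A (n + 1))"

definition maximal_datum :: "'a magma \<Rightarrow> nat \<Rightarrow> 'a list set" where
  "maximal_datum M n =
     (if n = 0 then {} else if n = 1 then tuples M 1
      else {b \<in> tuples M n. fully_associable M b})"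

lemma associativity_datum_le_maximal_datum:
  assumes "associativity_datum M A"
  shows "A n \<subseteq> maximal_datum M n"
  using assms by (cases "n \<ge> 2") (auto simp: associativity_datum_def maximal_datum_def not_le less_2_cases_iff)


section \<open>The categories and functors\<close>

text \<open>The subsets of the type \<^typ>\<open>'u\<close> play the role of the universe of sets.\<close>

definition Mag :: "('u magma, 'u \<Rightarrow> 'u) cat" where
  "Mag = \<lparr>Obj = {M. partial_unital_magma M},
          Hom = magma_hom,
          Id = (\<lambda>M. restrict id (carrier M)),
          Comp = (\<lambda>L M N g f. compose (carrier L) g f)\<rparr>"

definition WPM :: "('u magma, 'u \<Rightarrow> 'u) cat" where
  "WPM = \<lparr>Obj = {M. partial_unital_magma M \<and> weakly_associative M},
          Hom = magma_hom,
          Id = (\<lambda>M. restrict id (carrier M)),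
          Comp = (\<lambda>L M N g f. compose (carrier L) g f)\<rparr>"

definition PM :: "('u magma, 'u \<Rightarrow> 'u) cat" where
  "PM = \<lparr>Obj = {M. partial_unital_magma M \<and> associative M},
         Hom = magma_hom,
         Id = (\<lambda>M. restrict id (carrier M)),
         Comp = (\<lambda>L M N g f. compose (carrier L) g f)\<rparr>"

definition Mag_ad :: "('u magma \<times> (nat \<Rightarrow> 'u list set), 'u \<Rightarrow> 'u) cat" where
  "Mag_ad = \<lparr>Obj = {(M, A). partial_unital_magma M \<and> associativity_datum M A},
             Hom = (\<lambda>(M, A) (N, B). {f \<in> magma_hom M N. \<forall>n. map f ` A n \<subseteq> B n}),
             Id = (\<lambda>(M, A). restrict id (carrier M)),
             Comp = (\<lambda>(L, A) (M, B) (N, C) g f. compose (carrier L) g f)\<rparr>"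

definition Psi :: "('u magma, 'u \<Rightarrow> 'u, 'u magma, 'u \<Rightarrow> 'u) functor_data" where
  "Psi = \<lparr>Ob_map = (\<lambda>M. M), Hom_map = (\<lambda>M N f. f)\<rparr>"

definition Phi :: "('u magma, 'u \<Rightarrow> 'u, 'u magma, 'u \<Rightarrow> 'u) functor_data" where
  "Phi = \<lparr>Ob_map = (\<lambda>M. M), Hom_map = (\<lambda>M N f. f)\<rparr>"

definition sharp ::
  "('u magma, 'u \<Rightarrow> 'u, 'u magma \<times> (nat \<Rightarrow> 'u list set), 'u \<Rightarrow> 'u) functor_data" where
  "sharp = \<lparr>Ob_map = (\<lambda>M. (M, maximal_datum M)), Hom_map = (\<lambda>M N f. f)\<rparr>"

end

theory Submission
  imports Defs
begin

text \<open>
  Morphisms preserve bracketed products, hence full associability, so every magma morphism respects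
  the maximal data. That \<open>F\<^sub>n(M)\<close> is a datum at all only requires work for the insertion of units:
  the product of a tuple with an inserted unit along a tree is the product of the original tuple
  along the tree with the corresponding leaf pruned.
\<close>

section \<open>Trees and their partial operations\<close>

lemma leaves_pos: "0 < leaves T"
  by (induction T) auto

lemma leaves_eq_1_iff: "leaves T = Suc 0 \<longleftrightarrow> T = Leaf"
proof (cases T)
  case (Node S U)
  then show ?thesis
    using leaves_pos[of S] leaves_pos[of U] by auto
qed simp

text \<open>Definedness at a node in existential form. It stands in for the nested
  \<open>case\<close> of the defining equation, which is taken out of the simpset wherever this form
  is used.\<close>

lemma bracket_prod_Node_eq_Some:
  "bracket_prod M (Node S T) xs = Some z \<longleftrightarrow>
     (\<exists>x y. bracket_prod M S (take (leaves S) xs) = Some x \<and>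
        bracket_prod M T (drop (leaves S) xs) = Some y \<and> mult M x y = Some z)"
  by (auto split: option.splits)

lemma bracket_prod_Leaf_eq_Some: "bracket_prod M Leaf xs = Some v \<longleftrightarrow> xs = [v]"
  by (auto split: list.splits)

text \<open>A look at the root suffices: the value at a node is a value of \<open>mult\<close>, the
  value at a leaf is an entry of the tuple.\<close>

lemma bracket_prod_in_carrier:
  assumes "partial_unital_magma M" "set xs \<subseteq> carrier M" "bracket_prod M T xs = Some v"
  shows "v \<in> carrier M"
proof (cases T)
  case Leaf
  then show ?thesis using assms(2,3) by (simp add: bracket_prod_Leaf_eq_Some del: bracket_prod.simps)
next
  case (Node S U)
  then obtain x y where "mult M x y = Some v"
    using assms(3) by (auto simp: bracket_prod_Node_eq_Some simp del: bracket_prod.simps)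
  then show ?thesis using assms(1) by (auto simp: partial_unital_magma_def)
qed

lemma bracket_prod_map:
  assumes "f \<in> magma_hom M N"
  shows "bracket_prod M T xs = Some v \<Longrightarrow> bracket_prod N T (map f xs) = Some (f v)"
proof (induction T arbitrary: xs v)
  case Leaf
  then show ?case by (simp add: bracket_prod_Leaf_eq_Some del: bracket_prod.simps)
next
  case (Node S T)
  then obtain x y where "bracket_prod M S (take (leaves S) xs) = Some x"
    "bracket_prod M T (drop (leaves S) xs) = Some y" "mult M x y = Some v"
    by (auto simp: bracket_prod_Node_eq_Some simp del: bracket_prod.simps)
  then have "bracket_prod N S (take (leaves S) (map f xs)) = Some (f x)"
    "bracket_prod N T (drop (leaves S) (map f xs)) = Some (f y)" "mult N (f x) (f y) = Some (f v)"
    using Node.IH assms by (auto simp: take_map drop_map magma_hom_def simp del: bracket_prod.simps)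
  then show ?case by simp
qed

text \<open>\<open>T'\<close> arises from \<open>T\<close> by deleting the leaf over the unit and
  letting the sibling subtree take the place of their common parent. Both sides are option values,
  so definedness is transferred together with the product. A nonempty \<open>xs @ ys\<close>
  guarantees that the leaf has a parent.\<close>

lemma bracket_prod_insert_unit:
  assumes M: "partial_unital_magma M"
  shows "\<lbrakk>set (xs @ ys) \<subseteq> carrier M; xs @ ys \<noteq> []; leaves T = Suc (length (xs @ ys))\<rbrakk>
    \<Longrightarrow> \<exists>T'. leaves T' = length (xs @ ys) \<and>
          bracket_prod M T (xs @ unit M # ys) = bracket_prod M T' (xs @ ys)"
proof (induction T arbitrary: xs ys)
  case Leaf
  then show ?case by simp
next
  case (Node S T)
  \<comment> \<open>The unit laws hold only on the carrier, so they are stated for values of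
    bracketed products. They serve the two cases in which one child of the root is the unit leaf
    itself.\<close>
  have units: "mult M x (unit M) = Some x" "mult M (unit M) x = Some x"
    if "bracket_prod M U zs = Some x" "set zs \<subseteq> carrier M" for x U zs
    using bracket_prod_in_carrier[OF M that(2,1)] M by (auto simp: partial_unital_magma_def)
  show ?case
  \<comment> \<open>The left subtree consumes the first \<open>leaves S\<close> entries, and exactly
    \<open>length xs\<close> entries precede the unit. The inequality therefore says that the unit
    lies over the right subtree.\<close>
  proof (cases "leaves S \<le> length xs")
    case True
    define xs1 xs2 where "xs1 = take (leaves S) xs" and "xs2 = drop (leaves S) xs"
    have xs: "xs = xs1 @ xs2" and len: "length xs1 = leaves S"
      using True by (simp_all add: xs1_def xs2_def)
    show ?thesis
    \<comment> \<open>If nothing but the unit remains for \<open>T\<close>, then pruning leaves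
      \<open>S\<close>; otherwise the leaf is pruned inside \<open>T\<close> by induction.\<close>
    proof (cases "xs2 @ ys = []")
      case True
      have "T = Leaf" using True Node.prems len xs by (simp add: leaves_eq_1_iff)
      have "set xs1 \<subseteq> carrier M" using Node.prems(1) xs by simp
      then have "bracket_prod M (Node S T) (xs @ unit M # ys) = bracket_prod M S xs1"
        using True xs len \<open>T = Leaf\<close> units(1)[of S xs1]
        by (cases "bracket_prod M S xs1") simp_all
      moreover have "leaves S = length (xs @ ys)" "xs @ ys = xs1" using True xs len by simp_all
      ultimately show ?thesis by metis
    next
      case False
      have "\<exists>T'. leaves T' = length (xs2 @ ys) \<and>
          bracket_prod M T (xs2 @ unit M # ys) = bracket_prod M T' (xs2 @ ys)"
        using Node.prems xs len False by (intro Node.IH(2)) auto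
      then obtain T' where "leaves T' = length (xs2 @ ys)"
          "bracket_prod M T (xs2 @ unit M # ys) = bracket_prod M T' (xs2 @ ys)" by blast
      then show ?thesis
        using xs len by (intro exI[of _ "Node S T'"]) simp
    qed
  next
    case False
    \<comment> \<open>The left subtree takes all of \<open>xs\<close>, the unit and then
      \<open>k\<close> entries of \<open>ys\<close>.\<close>
    define k ys1 ys2 where "k = leaves S - Suc (length xs)" and "ys1 = take k ys" and "ys2 = drop k ys"
    have ys: "ys = ys1 @ ys2" by (simp add: ys1_def ys2_def)
    have len: "leaves S = Suc (length (xs @ ys1))" "length ys2 = leaves T"
      using False Node.prems(3) leaves_pos[of T] by (auto simp: k_def ys1_def ys2_def)
    show ?thesis
    proof (cases "xs @ ys1 = []")
      case True
      have "S = Leaf" using True len(1) by (simp add: leaves_eq_1_iff)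
      have "set ys2 \<subseteq> carrier M" using Node.prems(1) ys by simp
      then have "bracket_prod M (Node S T) (xs @ unit M # ys) = bracket_prod M T ys2"
        using True ys \<open>S = Leaf\<close> units(2)[of T ys2]
        by (cases "bracket_prod M T ys2") simp_all
      moreover have "leaves T = length (xs @ ys)" "xs @ ys = ys2" using True ys len by simp_all
      ultimately show ?thesis by metis
    next
      case False
      have "\<exists>S'. leaves S' = length (xs @ ys1) \<and>
          bracket_prod M S (xs @ unit M # ys1) = bracket_prod M S' (xs @ ys1)"
        using Node.prems ys len False by (intro Node.IH(1)) auto
      then obtain S' where "leaves S' = length (xs @ ys1)"
          "bracket_prod M S (xs @ unit M # ys1) = bracket_prod M S' (xs @ ys1)" by blast
      then show ?thesis
        using ys len by (intro exI[of _ "Node S' T"]) simp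
    qed
  qed
qed

section \<open>Associable tuples\<close>

text \<open>Definedness along every tree and agreement of the products merge into a single common
  value \<open>v\<close>, which can then be carried through unit insertion and along
  morphisms.\<close>

lemma associable_iff:
  "associable M b \<longleftrightarrow> 2 \<le> length b \<and> set b \<subseteq> carrier M \<and>
     (\<exists>v. \<forall>T. leaves T = length b \<longrightarrow> bracket_prod M T b = Some v)"
  (is "?L \<longleftrightarrow> ?R")
proof
  assume L: ?L
  then have eq: "bracket_prod M S b = bracket_prod M T b"
    if "leaves S = length b" "leaves T = length b" for S T
    using that unfolding associable_def by blast
  have ex: "\<exists>v. bracket_prod M T b = Some v" if "leaves T = length b" for T
    using L that unfolding associable_def multiplicable_def by blast
  have "\<exists>v. \<forall>T. leaves T = length b \<longrightarrow> bracket_prod M T b = Some v"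
    using eq ex by metis
  then show ?R using L unfolding associable_def multiplicable_def tuples_def by blast
next
  assume R: ?R
  then obtain v where v: "bracket_prod M T b = Some v" if "leaves T = length b" for T
    by blast
  with R show ?L
    unfolding associable_def multiplicable_def tuples_def by simp
qed

text \<open>There is only one tree with two leaves, so agreement is automatic and definedness is
  that of \<open>mult\<close>.\<close>

lemma associable_pair_iff:
  assumes "partial_unital_magma M"
  shows "associable M [x, y] \<longleftrightarrow> mult M x y \<noteq> None"
proof -
  have "T = Node Leaf Leaf" if "leaves T = 2" for T
  proof (cases T)
    case (Node S U)
    with that leaves_pos[of S] leaves_pos[of U] have "leaves S = Suc 0" "leaves U = Suc 0" by auto
    with Node show ?thesis by (simp add: leaves_eq_1_iff)
  qed (use that in simp)
  moreover have "leaves (Node Leaf Leaf) = 2" by simp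
  ultimately have "leaves T = length [x, y] \<longleftrightarrow> T = Node Leaf Leaf" for T by auto
  then have "associable M [x, y] \<longleftrightarrow> {x, y} \<subseteq> carrier M \<and> mult M x y \<noteq> None"
    unfolding associable_iff by auto
  moreover have "{x, y} \<subseteq> carrier M" if "mult M x y \<noteq> None"
    using that assms unfolding partial_unital_magma_def by blast
  ultimately show ?thesis by blast
qed

text \<open>Each tree for the longer tuple prunes to a tree for \<open>xs @ ys\<close>, and all of
  those give the same \<open>v\<close>.\<close>

lemma associable_insert_unit:
  assumes M: "partial_unital_magma M" and b: "associable M (xs @ ys)"
  shows "associable M (xs @ unit M # ys)"
proof -
  obtain v where v: "\<And>T. leaves T = length (xs @ ys) \<Longrightarrow> bracket_prod M T (xs @ ys) = Some v"
    using b by (auto simp: associable_iff)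
  have "set (xs @ ys) \<subseteq> carrier M" "xs @ ys \<noteq> []" using b by (auto simp: associable_iff)
  then have "bracket_prod M T (xs @ unit M # ys) = Some v"
    if "leaves T = Suc (length (xs @ ys))" for T
    using bracket_prod_insert_unit[OF M _ _ that] v by metis
  then show ?thesis using b M by (auto simp: associable_iff partial_unital_magma_def)
qed

lemma associable_map:
  assumes f: "f \<in> magma_hom M N" and b: "associable M b"
  shows "associable N (map f b)"
proof -
  obtain v where "\<And>T. leaves T = length b \<Longrightarrow> bracket_prod M T b = Some v"
    using b by (auto simp: associable_iff)
  then have "\<exists>v. \<forall>T. leaves T = length (map f b) \<longrightarrow> bracket_prod N T (map f b) = Some v"
    using bracket_prod_map[OF f] by auto
  moreover have "f ` carrier M \<subseteq> carrier N" using f by (auto simp: magma_hom_def)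
  ultimately show ?thesis using b by (auto simp: associable_iff)
qed

section \<open>Fully associable tuples\<close>

text \<open>Trades index arithmetic on \<open>slice\<close> for decompositions by concatenation,
  which behave well under passing to infixes, inserting an entry and \<open>map\<close>.\<close>

lemma fully_associable_iff:
  "fully_associable M b \<longleftrightarrow> 2 \<le> length b \<and>
     (\<forall>xs ys zs. b = xs @ ys @ zs \<longrightarrow> 2 \<le> length ys \<longrightarrow> associable M ys)"
  (is "?L \<longleftrightarrow> ?R")
proof
  assume L: ?L
  have "associable M ys" if "b = xs @ ys @ zs" "2 \<le> length ys" for xs ys zs
  proof -
    have "slice (Suc (length xs)) (length xs + length ys) b = ys"
      using that by (simp add: slice_def)
    moreover have "associable M (slice (Suc (length xs)) (length xs + length ys) b)"
      using L that unfolding fully_associable_def by simp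
    ultimately show ?thesis by simp
  qed
  then show ?R using L unfolding fully_associable_def multiplicable_def by blast
next
  assume R: ?R
  have "associable M (slice i j b)" if "1 \<le> i" "i < j" "j \<le> length b" for i j
  proof -
    have "b = take (i - 1) (take j b) @ slice i j b @ drop j b"
      unfolding slice_def by (metis append.assoc append_take_drop_id)
    moreover have "2 \<le> length (slice i j b)" using that by (simp add: slice_def)
    ultimately show ?thesis using R by blast
  qed
  \<comment> \<open>With both outer factors empty, \<open>b\<close> is an infix of itself; this
    yields the multiplicability that the definition demands separately.\<close>
  moreover have "associable M b"
    using R[THEN conjunct2, rule_format, of "[]" b "[]"] R by simp
  ultimately show ?L unfolding fully_associable_def associable_def by blast
qed

lemma fully_associable_length: "fully_associable M b \<Longrightarrow> 2 \<le> length b"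
  unfolding fully_associable_iff by blast

lemma fully_associable_infix:
  assumes "fully_associable M (xs @ ys @ zs)" "2 \<le> length ys"
  shows "fully_associable M ys"
  unfolding fully_associable_iff
proof (intro conjI allI impI)
  fix us vs ws assume "ys = us @ vs @ ws" "2 \<le> length vs"
  moreover from this have "xs @ ys @ zs = (xs @ us) @ vs @ (ws @ zs)" by simp
  ultimately show "associable M vs" using assms(1) unfolding fully_associable_iff by blast
qed (fact assms(2))

lemma fully_associable_imp_associable: "fully_associable M b \<Longrightarrow> associable M b"
  unfolding fully_associable_iff by (metis append_Nil append_Nil2)

lemma fully_associable_carrier: "fully_associable M b \<Longrightarrow> set b \<subseteq> carrier M"
  using fully_associable_imp_associable by (auto simp: associable_iff)

text \<open>The only infix of length at least 2 of a pair is the pair itself.\<close>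

lemma fully_associable_pair_iff:
  assumes "partial_unital_magma M"
  shows "fully_associable M [x, y] \<longleftrightarrow> mult M x y \<noteq> None"
proof -
  have "ys = [x, y]" if eq: "[x, y] = xs @ ys @ zs" and len: "2 \<le> length ys" for xs ys zs
  proof -
    have "length xs + length ys + length zs = 2"
      using arg_cong[OF eq, of length] by simp
    with len have "length xs = 0 \<and> length zs = 0" by linarith
    with eq show ?thesis by simp
  qed
  then have "associable M [x, y] \<Longrightarrow> fully_associable M [x, y]"
    unfolding fully_associable_iff by (metis associable_iff)
  then show ?thesis
    using associable_pair_iff[OF assms] fully_associable_imp_associable by blast
qed

lemma fully_associable_insert_unit:
  assumes M: "partial_unital_magma M" and b: "fully_associable M (xs @ ys)"
  shows "fully_associable M (xs @ unit M # ys)"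
  unfolding fully_associable_iff
proof (intro conjI allI impI)
  show "2 \<le> length (xs @ unit M # ys)" using fully_associable_length[OF b] by simp
next
  fix us vs ws assume eq: "xs @ unit M # ys = us @ vs @ ws" and len: "2 \<le> length vs"
  have sub: "associable M vs" if "xs @ ys = us' @ vs @ ws'" for us' ws'
    using b that len unfolding fully_associable_iff by blast
  \<comment> \<open>The infix \<open>vs\<close> ends before the inserted unit, starts after it, or
    contains it. In the first two cases it is already an infix of \<open>xs @ ys\<close>.\<close>
  consider (left) as where "xs = us @ vs @ as"
    | (right) as where "ys = as @ vs @ ws"
    | (mid) as bs where "vs = as @ unit M # bs" "xs = us @ as" "ys = bs @ ws"
    using eq by (auto simp: append_eq_append_conv2 append_eq_Cons_conv Cons_eq_append_conv)
  then show "associable M vs"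
  proof cases
    case left
    then show ?thesis using sub[of us "as @ ys"] by simp
  next
    case right
    then show ?thesis using sub[of "xs @ as" ws] by simp
  next
    case mid
    have decomp: "xs @ ys = us @ (as @ bs) @ ws" using mid by simp
    show ?thesis
    proof (cases "2 \<le> length (as @ bs)")
      case True
      then have "associable M (as @ bs)" using b decomp unfolding fully_associable_iff by blast
      then show ?thesis using associable_insert_unit[OF M] mid(1) by simp
    next
      \<comment> \<open>Removing the unit from \<open>vs\<close> leaves one entry \<open>c\<close>,
        too short for full associability of \<open>xs @ ys\<close> to say anything. The pair formed
        by \<open>c\<close> and the unit is associable by the unit law instead.\<close>
      case False
      with len mid(1) have "length (as @ bs) = Suc 0" by simp
      then obtain c where c: "as @ bs = [c]" by (metis length_0_conv length_Suc_conv)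
      then have "c \<in> carrier M"
        using fully_associable_carrier[OF b] by (simp only: decomp) simp
      then have "mult M c (unit M) \<noteq> None" "mult M (unit M) c \<noteq> None"
        using M by (auto simp: partial_unital_magma_def)
      moreover have "vs = [c, unit M] \<or> vs = [unit M, c]"
        using c mid(1) by (auto simp: append_eq_Cons_conv)
      ultimately show ?thesis using associable_pair_iff[OF M] by auto
    qed
  qed
qed

text \<open>A decomposition of \<open>map f b\<close> lifts to one of \<open>b\<close>, so every
  infix of the image is the image of an infix.\<close>

lemma fully_associable_map:
  assumes f: "f \<in> magma_hom M N" and b: "fully_associable M b"
  shows "fully_associable N (map f b)"
  unfolding fully_associable_iff
proof (intro conjI allI impI)
  show "2 \<le> length (map f b)" using fully_associable_length[OF b] by simp
next
  fix xs ys zs assume eq: "map f b = xs @ ys @ zs" and "2 \<le> length ys"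
  obtain xs' us where "b = xs' @ us" "map f us = ys @ zs"
    using map_eq_append_conv[THEN iffD1, OF eq] by metis
  moreover from this(2) obtain ys' zs' where "us = ys' @ zs'" "ys = map f ys'"
    using map_eq_append_conv[THEN iffD1] by metis
  ultimately have ys: "b = xs' @ ys' @ zs'" "ys = map f ys'" by simp_all
  have "2 \<le> length ys'" using \<open>2 \<le> length ys\<close> ys(2) by simp
  then have "associable M ys'" using b ys(1) unfolding fully_associable_iff by blast
  then show "associable N ys" using associable_map[OF f] ys(2) by simp
qed

section \<open>The maximal associativity datum\<close>

lemma mem_maximal_datum_iff:
  "b \<in> maximal_datum M n \<longleftrightarrow>
     length b = n \<and> (n = 1 \<and> set b \<subseteq> carrier M \<or> n \<ge> 2 \<and> fully_associable M b)"
proof -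
  consider "n = 0" | "n = 1" | "n \<ge> 2" by linarith
  then show ?thesis
    by cases (use fully_associable_carrier[of M b] in \<open>auto simp: maximal_datum_def tuples_def\<close>)
qed

text \<open>Covers the prefix and the suffix in condition (2) at once. A one-entry infix falls under
  the convention \<open>A_1 = M\<close>, where membership in the carrier is all that is
  asked.\<close>

lemma maximal_datum_infix:
  assumes "xs @ ys @ zs \<in> maximal_datum M n" "ys \<noteq> []"
  shows "ys \<in> maximal_datum M (length ys)"
proof (cases "2 \<le> length ys")
  case True
  then show ?thesis
    using assms fully_associable_infix[of M xs ys zs] by (auto simp: mem_maximal_datum_iff)
next
  case False
  moreover have "length ys \<noteq> 0" using assms(2) by simp
  ultimately have "length ys = 1" by linarith
  moreover have "set ys \<subseteq> carrier M"
    using assms(1) fully_associable_carrier[of M "xs @ ys @ zs"] by (auto simp: mem_maximal_datum_iff)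
  ultimately show ?thesis by (simp add: mem_maximal_datum_iff)
qed

lemma associativity_datum_maximal_datum:
  assumes M: "partial_unital_magma M"
  shows "associativity_datum M (maximal_datum M)"
  unfolding associativity_datum_def
proof (intro conjI allI ballI impI)
  show "maximal_datum M 2 = {[x, y] |x y. mult M x y \<noteq> None}"
    using fully_associable_pair_iff[OF M]
    by (auto simp: mem_maximal_datum_iff numeral_2_eq_2 length_Suc_conv)
next
  fix n b i assume b: "b \<in> maximal_datum M n" and i: "1 \<le> i \<and> i < n"
  have n: "length b = n" using b by (simp add: mem_maximal_datum_iff)
  have "take i b \<in> maximal_datum M (length (take i b))"
    using b i n by (intro maximal_datum_infix[of "[]" _ "drop i b" M n]) auto
  then show "take i b \<in> maximal_datum M i" using i n by simp
  have "drop i b \<in> maximal_datum M (length (drop i b))"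
    using b i n by (intro maximal_datum_infix[of "take i b" _ "[]" M n]) auto
  then show "drop i b \<in> maximal_datum M (n - i)" using n by simp
next
  fix n b i assume "2 \<le> (n::nat)" and b: "b \<in> maximal_datum M n"
  \<comment> \<open>Positions count from 1: cutting after \<open>i - 1\<close> entries puts the unit
    in front of the \<open>i\<close>-th entry, and at the end of the tuple for
    \<open>i = n + 1\<close>.\<close>
  then have "fully_associable M (take (i - 1) b @ drop (i - 1) b)"
    by (auto simp: mem_maximal_datum_iff)
  from fully_associable_insert_unit[OF M this]
  show "take (i - 1) b @ [unit M] @ drop (i - 1) b \<in> maximal_datum M (n + 1)"
    using b \<open>2 \<le> n\<close> by (auto simp: mem_maximal_datum_iff)
qed (auto simp: maximal_datum_def)

text \<open>This makes the extra condition on morphisms of \<open>Mag_ad\<close> automatic between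
  maximal data, which gives fullness of \<open>sharp\<close>.\<close>

lemma map_maximal_datum:
  assumes f: "f \<in> magma_hom M N"
  shows "map f ` maximal_datum M n \<subseteq> maximal_datum N n"
proof -
  have "f ` carrier M \<subseteq> carrier N" using f by (auto simp: magma_hom_def)
  then show ?thesis
    using fully_associable_map[OF f] by (fastforce simp: mem_maximal_datum_iff)
qed

section \<open>Categories of magmas\<close>

lemma id_magma_hom: "partial_unital_magma M \<Longrightarrow> restrict id (carrier M) \<in> magma_hom M M"
  by (auto simp: magma_hom_def partial_unital_magma_def)

lemma magma_hom_funcset: "f \<in> magma_hom M N \<Longrightarrow> f \<in> carrier M \<rightarrow> carrier N"
  and magma_hom_extensional: "f \<in> magma_hom M N \<Longrightarrow> f \<in> extensional (carrier M)"
  by (simp_all add: magma_hom_def PiE_def)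

lemma compose_magma_hom:
  assumes L: "partial_unital_magma L" and f: "f \<in> magma_hom L M" and g: "g \<in> magma_hom M N"
  shows "compose (carrier L) g f \<in> magma_hom L N"
proof -
  have "compose (carrier L) g f \<in> carrier L \<rightarrow>\<^sub>E carrier N"
    using funcset_compose[OF magma_hom_funcset[OF f] magma_hom_funcset[OF g]]
    by (simp add: PiE_def)
  moreover have "compose (carrier L) g f (unit L) = unit N"
    using L f g by (simp add: compose_eq magma_hom_def partial_unital_magma_def)
  moreover have "mult N (compose (carrier L) g f x) (compose (carrier L) g f y) =
      Some (compose (carrier L) g f z)" if xyz: "mult L x y = Some z" for x y z
  proof -
    have "x \<in> carrier L" "y \<in> carrier L" "z \<in> carrier L"
      using L xyz unfolding partial_unital_magma_def by blast+
    moreover have "mult M (f x) (f y) = Some (f z)"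
      using f xyz unfolding magma_hom_def by blast
    then have "mult N (g (f x)) (g (f y)) = Some (g (f z))"
      using g unfolding magma_hom_def by blast
    ultimately show ?thesis by (simp add: compose_eq)
  qed
  ultimately show ?thesis unfolding magma_hom_def by blast
qed

lemma compose_restrict_id_right:
  assumes "f \<in> magma_hom M N"
  shows "compose (carrier M) f (restrict id (carrier M)) = f"
  using compose_Id[OF magma_hom_funcset[OF assms] magma_hom_extensional[OF assms]]
  by (simp add: id_def)

lemma compose_restrict_id_left:
  assumes "f \<in> magma_hom M N"
  shows "compose (carrier M) (restrict id (carrier N)) f = f"
  using Id_compose[OF magma_hom_funcset[OF assms] magma_hom_extensional[OF assms]]
  by (simp add: id_def)

lemma compose_magma_hom_assoc:
  assumes "f \<in> magma_hom K L"
  shows "compose (carrier K) h (compose (carrier K) g f) =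
    compose (carrier K) (compose (carrier L) h g) f"
  using compose_assoc[OF magma_hom_funcset[OF assms]] .

text \<open>\<open>PM\<close>, \<open>WPM\<close> and \<open>Mag\<close> differ only in their sets
  of objects, so one argument serves all three.\<close>

lemma category_magmas:
  assumes "\<And>M. M \<in> Obs \<Longrightarrow> partial_unital_magma M"
  shows "category \<lparr>Obj = Obs, Hom = magma_hom, Id = (\<lambda>M. restrict id (carrier M)),
    Comp = (\<lambda>L M N g f. compose (carrier L) g f)\<rparr>"
  by standard
    (simp_all add: assms id_magma_hom compose_magma_hom compose_restrict_id_right
      compose_restrict_id_left compose_magma_hom_assoc)

lemma category_Mag: "category Mag" and category_WPM: "category WPM" and category_PM: "category PM"
  unfolding Mag_def WPM_def PM_def by (rule category_magmas; simp)+

section \<open>The category of magmas with associativity data\<close>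

lemma associativity_datum_carrier:
  assumes "associativity_datum M A" "b \<in> A n"
  shows "set b \<subseteq> carrier M"
proof -
  have "b \<in> maximal_datum M n"
    using associativity_datum_le_maximal_datum[OF assms(1)] assms(2) by blast
  then show ?thesis
    using fully_associable_carrier[of M b] by (auto simp: mem_maximal_datum_iff)
qed

text \<open>The identity morphism is \<open>undefined\<close> off the carrier; it fixes the tuples
  of a datum because their entries lie in the carrier. The same point underlies the rule for
  composites below.\<close>

lemma map_id_datum:
  assumes "associativity_datum M A" "b \<in> A n"
  shows "map (restrict id (carrier M)) b = b"
  using associativity_datum_carrier[OF assms] by (simp add: map_idI subset_iff)

lemma map_compose_datum:
  assumes "associativity_datum M A" "b \<in> A n"
  shows "map (compose (carrier M) g f) b = map g (map f b)"
  using associativity_datum_carrier[OF assms] by (simp add: compose_eq subset_iff)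

lemma category_Mag_ad: "category Mag_ad"
proof
  fix X :: "'u magma \<times> (nat \<Rightarrow> 'u list set)"
  assume "X \<in> Obj Mag_ad"
  then show "Id Mag_ad X \<in> Hom Mag_ad X X"
    by (auto simp: Mag_ad_def id_magma_hom map_id_datum)
next
  fix X Y Z :: "'u magma \<times> (nat \<Rightarrow> 'u list set)" and f g
  assume "X \<in> Obj Mag_ad" "f \<in> Hom Mag_ad X Y" "g \<in> Hom Mag_ad Y Z"
  \<comment> \<open>Without \<open>map_map\<close> the image stays in the form
    \<open>map g (map f b)\<close>, so that the conditions on \<open>f\<close> and \<open>g\<close>
    apply in turn.\<close>
  then show "Comp Mag_ad X Y Z g f \<in> Hom Mag_ad X Z"
    by (auto simp: Mag_ad_def compose_magma_hom map_compose_datum image_subset_iff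
        simp del: map_map split: prod.splits)
qed (auto simp: Mag_ad_def compose_restrict_id_right compose_restrict_id_left
    intro: compose_magma_hom_assoc split: prod.splits)

section \<open>Full faithfulness of the three functors\<close>

theorem proposition3p15:
  shows "fully_faithful_functor (PM :: ('u magma, 'u \<Rightarrow> 'u) cat) WPM Psi
       \<and> fully_faithful_functor (WPM :: ('u magma, 'u \<Rightarrow> 'u) cat) Mag Phi
       \<and> fully_faithful_functor (Mag :: ('u magma, 'u \<Rightarrow> 'u) cat) Mag_ad sharp"
proof (intro conjI)
  \<comment> \<open>Source and target share \<open>magma_hom\<close> and the functor is the identity
    on morphisms, so bijectivity is immediate. On objects, \<open>associative\<close> contains
    \<open>weakly_associative\<close>.\<close>
  show "fully_faithful_functor (PM :: ('u magma, 'u \<Rightarrow> 'u) cat) WPM Psi"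
    unfolding fully_faithful_functor_def cat_functor_def cat_functor_axioms_def
    by (simp add: category_PM category_WPM)
      (auto simp: PM_def WPM_def Psi_def associative_def bij_betw_def)
  show "fully_faithful_functor (WPM :: ('u magma, 'u \<Rightarrow> 'u) cat) Mag Phi"
    unfolding fully_faithful_functor_def cat_functor_def cat_functor_axioms_def
    by (simp add: category_Mag category_WPM)
      (auto simp: Mag_def WPM_def Phi_def bij_betw_def)
  \<comment> \<open>With equal hom-sets, \<open>sharp\<close> too acts as an identity on morphisms.
    What remains is that the maximal datum makes \<open>(M, maximal_datum M)\<close> an
    object.\<close>
  have Hom_eq: "Hom Mag_ad (M, maximal_datum M) (N, maximal_datum N) = magma_hom M N"
    for M N :: "'u magma"
    using map_maximal_datum[of _ M N] by (simp add: Mag_ad_def) blast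
  show "fully_faithful_functor (Mag :: ('u magma, 'u \<Rightarrow> 'u) cat) Mag_ad sharp"
    unfolding fully_faithful_functor_def cat_functor_def cat_functor_axioms_def
    by (simp add: category_Mag category_Mag_ad sharp_def Hom_eq)
      (auto simp: Mag_def Mag_ad_def bij_betw_def associativity_datum_maximal_datum)
qed

end
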